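(* Let $d\ge1$ be an integer and let $S_{\mathbf a}\subset\mathbb R^d$ be the one-row Hermite normal form simplex associated with $\mathbf a=(N-1,\ldots,N-1,N)\in\mathbb N^d$. If $N=dk$ or $N=dk+1$ for some positive integer $k$, then $S_{\mathbf a}$ is Ehrhart positive.
   Context: For $\mathbf a=(a_1,\ldots,a_{d-1},N)\in\mathbb Z^d$ with $0\le a_i<N$, the one-row Hermite normal form simplex $S_{\mathbf a}$ is the convex hull in $\mathbb R^d$ of $\mathbf v_0=\mathbf 0$, $\mathbf v_i=\mathbf e_i$ (standard unit vectors) for $1\le i\le d-1$, and $\mathbf v_d=\mathbf a$. For a $d$-dimensional lattice polytope $P\subset\mathbb R^d$, the Ehrhart polynomial $\mathcal L_P$ is the polynomial of degree $d$ with $\mathcal L_P(m)=|mP\cap\mathbb Z^d|$ for all integers $m\ge0$. $P$ is Ehrhart positive if all coefficients of $t^0,\ldots,t^d$ in $\mathcal L_P(t)$ are strictly positive. *)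

theory Defs
  imports "HOL-Analysis.Analysis" "HOL-Computational_Algebra.Polynomial"
begin

text \<open>
  The space $R^d$ is \<open>real ^ 'n\<close> with \<open>CARD('n) = d\<close>. The class \<open>linorder\<close> on the finite index
  type gives the order of the coordinates, so that the largest index is the $d$-th one. Numeral
  types (and \<open>unit\<close>) provide an instance for every $d \ge 1$.
\<close>

definition last_index :: "'n::{finite,linorder}" where
  "last_index = Max UNIV"

definition one_row_hnf_simplex :: "int ^ 'n::{finite,linorder} \<Rightarrow> (real ^ 'n::{finite,linorder}) set" where
  "one_row_hnf_simplex a =
     convex hull ({0} \<union> {axis i 1 | i. i \<noteq> last_index} \<union> {\<chi> i. of_int (a $ i)})"

definition integer_points :: "(real ^ 'n::finite) set" where
  "integer_points = {x. \<forall>i. x $ i \<in> \<int>}"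

text \<open>
  The degree is required to be the dimension of the ambient space: the notion is meant for
  full-dimensional lattice polytopes. For an unbounded set \<open>card\<close> may be the junk value \<open>0\<close>, but
  only bounded sets are of interest here.
\<close>

definition is_ehrhart_poly :: "(real ^ 'n::finite) set \<Rightarrow> real poly \<Rightarrow> bool" where
  "is_ehrhart_poly P p \<longleftrightarrow>
     degree p = CARD('n) \<and>
     (\<forall>m::nat. poly p (real m) = real (card (((\<lambda>x. real m *\<^sub>R x) ` P) \<inter> integer_points)))"

lemma is_ehrhart_poly_unique:
  assumes "is_ehrhart_poly P p" and "is_ehrhart_poly P q"
  shows "p = q"
proof (rule ccontr)
  assume "p \<noteq> q"
  then have "finite {x. poly (p - q) x = 0}"
    by (intro poly_roots_finite) simp
  moreover have "range real \<subseteq> {x. poly (p - q) x = 0}"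
    using assms by (auto simp: is_ehrhart_poly_def)
  ultimately have "finite (range real)"
    by (rule rev_finite_subset)
  then show False
    using finite_imageD[OF _ inj_of_nat] by auto
qed

text \<open>
  By uniqueness the witness \<open>p\<close> is the Ehrhart polynomial; quantifying existentially makes its
  existence part of the property.
\<close>

definition ehrhart_positive :: "(real ^ 'n::finite) set \<Rightarrow> bool" where
  "ehrhart_positive P \<longleftrightarrow> (\<exists>p. is_ehrhart_poly P p \<and> (\<forall>i \<le> CARD('n). coeff p i > 0))"

end

theory Submission imports Defs
begin

text \<open>
  Splitting the lattice points of $m S$ by the common fractional part $r/N$ of their barycentric
  coordinates gives $L(m) = \sum_{r<N} {m + d - \lceil d r / N \rceil \choose d}$. For $N = dk$ and
  $N = dk + 1$ each value $\lceil d r / N \rceil \in \{1,\ldots,d-1\}$ is taken $k$ times, and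
  the hockey-stick identity yields
  $L(t) = {t+d \choose d} - \epsilon {t \choose d} + k ({t+d \choose d+1} - {t \choose d+1})$
  with $\epsilon = 1$ if $N = dk$ and $\epsilon = 0$ otherwise. Up to sign, the falling factorial
  has the coefficients of the rising factorial, so no difference has a negative coefficient.
\<close>

section \<open>Nonnegative integer vectors of bounded sum\<close>

text \<open>Induction on \<open>A\<close>: the value \<open>c\<close> at the new index leaves the
  bound \<open>M - c\<close> for the other indices, and the hockey-stick identity adds up the
  counts. Vanishing outside \<open>A\<close> identifies a function with its restriction to
  \<open>A\<close>.\<close>

lemma card_bounded_sum_functions:
  assumes "finite A"
  shows "finite {f :: 'a \<Rightarrow> nat. (\<forall>i. i \<notin> A \<longrightarrow> f i = 0) \<and> sum f A \<le> M} \<and>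
    card {f :: 'a \<Rightarrow> nat. (\<forall>i. i \<notin> A \<longrightarrow> f i = 0) \<and> sum f A \<le> M} = (M + card A) choose card A"
  using assms
proof (induction A arbitrary: M rule: finite_induct)
  case empty
  have "{f :: 'a \<Rightarrow> nat. (\<forall>i. i \<notin> {} \<longrightarrow> f i = 0) \<and> sum f {} \<le> M} = {\<lambda>_. 0}"
    by auto
  then show ?case by simp
next
  case (insert a A)
  define S where "S = (\<lambda>A M. {f :: 'a \<Rightarrow> nat. (\<forall>i. i \<notin> A \<longrightarrow> f i = 0) \<and> sum f A \<le> M})"
  have fin: "finite (S A M)" and crd: "card (S A M) = (M + card A) choose card A" for M
    using insert.IH[of M] by (auto simp: S_def)
  have sum_upd: "(\<Sum>i\<in>A. if i = a then c else f i) = sum f A" for f :: "'a \<Rightarrow> nat" and c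
    using insert.hyps by (intro sum.cong) auto
  have bij: "bij_betw (\<lambda>(c, f). f(a := c)) (SIGMA c:{..M}. S A (M - c)) (S (insert a A) M)"
  proof (rule bij_betw_byWitness[where f' = "\<lambda>f. (f a, f(a := 0))"])
    show "\<forall>p\<in>SIGMA c:{..M}. S A (M - c). (\<lambda>f. (f a, f(a := 0))) ((\<lambda>(c, f). f(a := c)) p) = p"
      using insert.hyps by (auto simp: S_def fun_eq_iff)
    show "(\<lambda>(c, f). f(a := c)) ` (SIGMA c:{..M}. S A (M - c)) \<subseteq> S (insert a A) M"
      using insert.hyps by (auto simp: S_def sum_upd)
    show "(\<lambda>f. (f a, f(a := 0))) ` S (insert a A) M \<subseteq> (SIGMA c:{..M}. S A (M - c))"
      using insert.hyps by (auto simp: S_def sum_upd)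
  qed auto
  have "finite (S (insert a A) M)"
    using bij_betw_finite[OF bij] fin by auto
  moreover have "card (S (insert a A) M) = (M + card (insert a A)) choose card (insert a A)"
  proof -
    have "card (S (insert a A) M) = (\<Sum>c\<le>M. (M - c + card A) choose card A)"
      using bij_betw_same_card[OF bij] fin by (simp add: crd)
    also have "\<dots> = (\<Sum>c\<le>M. (card A + c) choose card A)"
      by (rule sum.reindex_bij_witness[of _ "\<lambda>c. M - c" "\<lambda>c. M - c"]) (auto simp: add.commute)
    also have "\<dots> = (card A + M + 1) choose (card A + 1)"
      by (rule choose_rising_sum)
    finally show ?thesis
      using insert.hyps by (simp add: add.commute)
  qed
  ultimately show ?case
    by (simp add: S_def)
qed

lemma card_bounded_sum_UNIV:
  "card {f :: 'n::finite \<Rightarrow> nat. sum f UNIV \<le> M} = (M + CARD('n)) choose CARD('n)"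
  "finite {f :: 'n::finite \<Rightarrow> nat. sum f UNIV \<le> M}"
  using card_bounded_sum_functions[of "UNIV :: 'n set" M] by auto

section \<open>Dilated simplices with a vertex at the origin\<close>

text \<open>The vertex 0 contributes nothing to a convex combination, so its weight becomes the
  slack \<open>1 - sum u UNIV\<close>, and the equation on the weights relaxes to an
  inequality.\<close>

lemma convex_hull_insert_0_range:
  fixes v :: "'n::finite \<Rightarrow> 'a::real_vector"
  shows "convex hull (insert 0 (range v)) =
    {\<Sum>i\<in>UNIV. u i *\<^sub>R v i | u. (\<forall>i. 0 \<le> u i) \<and> sum u UNIV \<le> 1}" (is "?L = ?R")
proof
  have "insert 0 (range v) \<subseteq> ?R"
  proof -
    have "0 \<in> ?R"
      by (rule CollectI, rule exI[of _ "\<lambda>_. 0"]) simp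
    moreover have "v j \<in> ?R" for j
      by (rule CollectI, rule exI[of _ "\<lambda>i. if i = j then 1 else 0"])
        (simp add: if_distrib[of "\<lambda>c. c *\<^sub>R _"] cong: if_cong)
    ultimately show ?thesis by blast
  qed
  moreover have "convex ?R"
  proof (rule convexI)
    fix x y and s t :: real
    assume "x \<in> ?R" "y \<in> ?R" and st: "0 \<le> s" "0 \<le> t" "s + t = 1"
    then obtain u w where u: "\<forall>i. 0 \<le> u i" "sum u UNIV \<le> 1" "x = (\<Sum>i\<in>UNIV. u i *\<^sub>R v i)"
      and w: "\<forall>i. 0 \<le> w i" "sum w UNIV \<le> 1" "y = (\<Sum>i\<in>UNIV. w i *\<^sub>R v i)"
      by blast
    have "s *\<^sub>R x + t *\<^sub>R y = (\<Sum>i\<in>UNIV. (s * u i + t * w i) *\<^sub>R v i)"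
      by (simp add: u w scaleR_sum_right scaleR_add_left sum.distrib)
    moreover have "(\<Sum>i\<in>UNIV. s * u i + t * w i) \<le> 1"
      using convex_bound_le[OF u(2) w(2) st] by (simp add: sum.distrib sum_distrib_left)
    moreover have "\<forall>i. 0 \<le> s * u i + t * w i"
      using u w st by simp
    ultimately show "s *\<^sub>R x + t *\<^sub>R y \<in> ?R"
      by (intro CollectI exI[of _ "\<lambda>i. s * u i + t * w i"]) auto
  qed
  ultimately show "?L \<subseteq> ?R"
    by (rule hull_minimal)
next
  show "?R \<subseteq> ?L"
  proof
    fix x assume "x \<in> ?R"
    then obtain u where u: "\<forall>i. 0 \<le> u i" "sum u UNIV \<le> 1" "x = (\<Sum>i\<in>UNIV. u i *\<^sub>R v i)"
      by blast
    \<comment> \<open>The index \<open>None\<close> stands for the vertex 0 and carries the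
      slack.\<close>
    define w where "w = (\<lambda>j. case j of None \<Rightarrow> 1 - sum u UNIV | Some i \<Rightarrow> u i)"
    define y where "y = (\<lambda>j. case j of None \<Rightarrow> 0 | Some i \<Rightarrow> v i)"
    have "(\<Sum>j\<in>UNIV. w j *\<^sub>R y j) \<in> ?L"
    proof (rule convex_sum)
      show "sum w UNIV = 1"
        by (simp add: UNIV_option_conv w_def sum.reindex)
      show "w j \<ge> 0" for j
        using u by (cases j) (auto simp: w_def)
      show "y j \<in> ?L" for j
        by (rule hull_inc) (auto simp: y_def split: option.split)
    qed auto
    also have "(\<Sum>j\<in>UNIV. w j *\<^sub>R y j) = x"
      by (simp add: UNIV_option_conv w_def y_def sum.reindex u)
    finally show "x \<in> ?L" .
  qed
qed

text \<open>Dilation multiplies the weights by \<open>m\<close>. The converse divides by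
  \<open>m\<close>, so \<open>m = 0\<close> is treated apart: all weights then vanish.\<close>

lemma dilated_convex_hull_insert_0_range:
  fixes v :: "'n::finite \<Rightarrow> 'a::real_vector"
  assumes "0 \<le> m"
  shows "(\<lambda>x. m *\<^sub>R x) ` (convex hull (insert 0 (range v))) =
    {\<Sum>i\<in>UNIV. u i *\<^sub>R v i | u. (\<forall>i. 0 \<le> u i) \<and> sum u UNIV \<le> m}" (is "?L = ?R")
proof
  show "?L \<subseteq> ?R"
  proof
    fix x assume "x \<in> ?L"
    then obtain u where u: "\<forall>i. 0 \<le> u i" "sum u UNIV \<le> 1" "x = m *\<^sub>R (\<Sum>i\<in>UNIV. u i *\<^sub>R v i)"
      unfolding convex_hull_insert_0_range by blast
    then show "x \<in> ?R"
      using assms mult_left_mono[OF u(2) assms]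
      by (intro CollectI exI[of _ "\<lambda>i. m * u i"]) (auto simp: scaleR_sum_right sum_distrib_left)
  qed
  show "?R \<subseteq> ?L"
  proof
    fix x assume "x \<in> ?R"
    then obtain u where u: "\<forall>i. 0 \<le> u i" "sum u UNIV \<le> m" "x = (\<Sum>i\<in>UNIV. u i *\<^sub>R v i)"
      by blast
    show "x \<in> ?L"
    proof (cases "m = 0")
      case True
      then have "sum u UNIV = 0"
        using u by (simp add: order_antisym sum_nonneg)
      then have "\<forall>i. u i = 0"
        using u by (simp add: sum_nonneg_eq_0_iff)
      then have "x = m *\<^sub>R 0"
        using u by simp
      moreover have "0 \<in> convex hull (insert 0 (range v))"
        by (simp add: hull_inc)
      ultimately show ?thesis by blast
    next
      case False
      have "x = m *\<^sub>R (\<Sum>i\<in>UNIV. (u i / m) *\<^sub>R v i)"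
        using False u by (simp add: scaleR_sum_right)
      moreover have "(\<Sum>i\<in>UNIV. u i / m) \<le> 1"
        using False u assms by (simp flip: sum_divide_distrib)
      moreover have "\<forall>i. 0 \<le> u i / m"
        using u assms by simp
      ultimately show ?thesis
        unfolding convex_hull_insert_0_range by (intro image_eqI CollectI exI[of _ "\<lambda>i. u i / m"]) auto
    qed
  qed
qed

section \<open>Lattice points of the dilated one-row simplex\<close>

text \<open>An \<open>axis\<close> vertex affects only its own coordinate, whereas each unit of
  weight on \<open>a\<close> adds \<open>N\<close> to the last coordinate and \<open>N - 1\<close>
  to every other one.\<close>

lemma mem_dilated_one_row_simplex:
  fixes a :: "int ^ 'n::{finite,linorder}" and N m :: nat and y :: "real ^ 'n::{finite,linorder}"
  assumes "a = (\<chi> i. if i = last_index then int N else int N - 1)"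
  shows "y \<in> (\<lambda>x. real m *\<^sub>R x) ` one_row_hnf_simplex a \<longleftrightarrow>
    (\<exists>u. (\<forall>i. 0 \<le> u i) \<and> sum u UNIV \<le> real m \<and>
      (\<forall>i. y $ i = (if i = last_index then real N * u last_index
                    else u i + (real N - 1) * u last_index)))"
proof -
  \<comment> \<open>No \<open>axis\<close> vertex uses the index \<open>last_index\<close>, so it is
    free to stand for \<open>a\<close>.\<close>
  define v :: "'n \<Rightarrow> real ^ 'n::{finite,linorder}"
    where "v = (\<lambda>i. if i = last_index then (\<chi> i. of_int (a $ i)) else axis i 1)"
  have "{0} \<union> {axis i 1 | i. i \<noteq> last_index} \<union> {\<chi> i. of_int (a $ i)} = insert 0 (range v)"
    by (auto simp: v_def)
  then have S: "one_row_hnf_simplex a = convex hull (insert 0 (range v))"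
    by (simp add: one_row_hnf_simplex_def)
  have comp: "(\<Sum>i\<in>UNIV. u i *\<^sub>R v i) $ j =
      (if j = last_index then real N * u last_index else u j + (real N - 1) * u last_index)"
    for u j
  proof -
    have "(\<Sum>i\<in>UNIV. u i *\<^sub>R v i) $ j = (\<Sum>i\<in>UNIV. u i * v i $ j)"
      by simp
    also have "\<dots> = u last_index * v last_index $ j + (\<Sum>i\<in>UNIV - {last_index}. u i * v i $ j)"
      by (simp add: sum.remove[of _ last_index])
    also have "(\<Sum>i\<in>UNIV - {last_index}. u i * v i $ j) =
        (\<Sum>i\<in>UNIV - {last_index}. if i = j then u j else 0)"
      by (intro sum.cong) (auto simp: v_def axis_def)
    also have "\<dots> = (if j = last_index then 0 else u j)"
      by (simp add: sum.delta)
    finally show ?thesis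
      by (simp add: v_def assms)
  qed
  show ?thesis
    unfolding S dilated_convex_hull_insert_0_range[OF of_nat_0_le_iff] vec_eq_iff mem_Collect_eq comp
    by blast
qed

text \<open>
  The barycentric coordinates of a lattice point of the dilated simplex all have the same
  fractional part \<open>r / N\<close>; the function \<open>f\<close> records their integer parts.
\<close>

lemma lattice_points_dilated_one_row_simplex:
  fixes a :: "int ^ 'n::{finite,linorder}" and N m :: nat
  assumes a: "a = (\<chi> i. if i = last_index then int N else int N - 1)" and N: "N > 0"
  shows "bij_betw
    (\<lambda>(r, f). \<chi> i. if i = last_index then real (f last_index * N + r)
                   else real (f i + (N - 1) * f last_index + r))
    (SIGMA r:{..<N}. {f :: 'n \<Rightarrow> nat. N * sum f UNIV + CARD('n) * r \<le> N * m})
    ((\<lambda>x. real m *\<^sub>R x) ` one_row_hnf_simplex a \<inter> integer_points)"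
    (is "bij_betw ?pt ?A ?B")
proof (rule bij_betw_imageI)
  show "inj_on ?pt ?A"
  proof (rule inj_onI)
    fix p q assume "p \<in> ?A" "q \<in> ?A" and pq: "?pt p = ?pt q"
    then obtain r f s g where p: "p = (r, f)" and q: "q = (s, g)" and rs: "r < N" "s < N"
      by auto
    have eq: "?pt (r, f) = ?pt (s, g)"
      using pq unfolding p q .
    define l where "l = (last_index :: 'n)"
    have comp: "?pt (r, f) $ i = ?pt (s, g) $ i" for i
      using eq by simp
    \<comment> \<open>The last coordinate alone determines \<open>f l\<close> and \<open>r\<close>,
      as quotient and remainder modulo \<open>N\<close>; the other coordinates then give the other
      values of \<open>f\<close>.\<close>
    have "real (f l * N + r) = real (g l * N + s)"
      using comp[of l] by (simp add: l_def)
    then have *: "f l * N + r = g l * N + s"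
      by (rule of_nat_eq_iff[THEN iffD1])
    have "f l = g l"
      using arg_cong[OF *, of "\<lambda>x. x div N"] rs by simp
    moreover have "r = s"
      using * calculation by simp
    moreover have "f i = g i" for i
    proof (cases "i = l")
      case False
      then have "real (f i + (N - 1) * f l + r) = real (g i + (N - 1) * g l + s)"
        using comp[of i] by (simp add: l_def)
      then show ?thesis
        using calculation by simp
    qed (use calculation in simp)
    ultimately show "p = q"
      unfolding p q by auto
  qed
  show "?pt ` ?A = ?B"
  proof (intro equalityI subsetI)
    fix y assume "y \<in> ?pt ` ?A"
    then obtain r f where "r < N" and le: "N * sum f UNIV + CARD('n) * r \<le> N * m"
      and y: "y = ?pt (r, f)"
      by auto
    \<comment> \<open>These are the weights of the vertices; \<open>N\<close> times their sum is the
      left side of the inequality that bounds \<open>f\<close> and \<open>r\<close>.\<close>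
    define u where "u = (\<lambda>i. real (f i) + real r / real N)"
    have "real (N * sum f UNIV + CARD('n) * r) \<le> real (N * m)"
      using le by (rule of_nat_mono)
    moreover have "real N * sum u UNIV = real N * real (sum f UNIV) + real CARD('n) * real r"
      using N by (simp add: u_def sum.distrib distrib_left)
    ultimately have "real N * sum u UNIV \<le> real N * real m"
      by simp
    then have "sum u UNIV \<le> real m"
      using N by simp
    moreover have "\<forall>i. y $ i = (if i = last_index then real N * u last_index
                    else u i + (real N - 1) * u last_index)"
      using N by (simp add: y u_def of_nat_diff field_simps)
    moreover have "\<forall>i. 0 \<le> u i"
      by (simp add: u_def)
    ultimately have "y \<in> (\<lambda>x. real m *\<^sub>R x) ` one_row_hnf_simplex a"
      unfolding mem_dilated_one_row_simplex[OF a] by blast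
    moreover have "y \<in> integer_points"
      by (simp add: integer_points_def y)
    ultimately show "y \<in> ?B" by blast
  next
    fix y assume "y \<in> ?B"
    then obtain u where u: "\<forall>i. 0 \<le> u i" "sum u UNIV \<le> real m"
      and y: "\<forall>i. y $ i = (if i = last_index then real N * u last_index
                    else u i + (real N - 1) * u last_index)"
      and int: "\<forall>i. y $ i \<in> \<int>"
      by (auto simp: mem_dilated_one_row_simplex[OF a] integer_points_def)
    define l where "l = (last_index :: 'n)"
    have yl: "y $ l = real N * u l" and yi: "i \<noteq> l \<Longrightarrow> y $ i = u i + (real N - 1) * u l" for i
      using y by (auto simp: l_def)
    \<comment> \<open>The last coordinate \<open>N * u l\<close> is a natural number; its residue
      modulo \<open>N\<close> will be the numerator of the common fractional part.\<close>
    have "y $ l \<in> \<nat>"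
      using int u(1) by (simp add: Nats_altdef2 yl flip: yl) (simp add: yl)
    then obtain j where j: "y $ l = real j"
      by (auto elim: Nats_cases)
    define r where "r = j mod N"
    have r: "r < N" using N by (simp add: r_def)
    have "real j = real (j div N * N + r)"
      by (simp add: r_def)
    then have ul: "u l = real (j div N) + real r / real N"
      using j yl N by (simp add: field_simps)
    have "\<exists>c. u i = real c + real r / real N" for i
    proof (cases "i = l")
      case True
      then show ?thesis using ul by blast
    next
      case False
      \<comment> \<open>With \<open>q = j div N\<close>, the product \<open>(N - 1) * u l\<close>
        equals \<open>q * (N - 1) + r - r / N\<close>, so subtracting it from the integer
        \<open>y $ i\<close> leaves the fractional part \<open>r / N\<close>.\<close>
      have "u i - real r / real N = y $ i - real (j div N * (N - 1) + r)"
        using yi[OF False] ul N by (simp add: of_nat_diff field_simps)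
      also have "\<dots> \<in> \<int>"
        using int by (intro Ints_diff) auto
      finally obtain z where z: "u i - real r / real N = of_int z"
        by (auto elim: Ints_cases)
      \<comment> \<open>The integer \<open>z\<close> exceeds -1 because \<open>u i\<close> is
        nonnegative, so it is a natural number.\<close>
      have "real r / real N < 1"
        using r by simp
      then have "of_int z > (-1 :: real)"
        using z u(1)[rule_format, of i] by linarith
      then have "z \<ge> 0" by linarith
      then show ?thesis
        using z by (intro exI[of _ "nat z"]) (simp add: algebra_simps)
    qed
    then obtain f where f: "\<And>i. u i = real (f i) + real r / real N"
      by metis
    have "real (N * sum f UNIV + CARD('n) * r) = real N * sum u UNIV"
      using N by (simp add: f sum.distrib distrib_left)
    also have "\<dots> \<le> real (N * m)"
      using u(2) by (simp add: mult_left_mono)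
    finally have "N * sum f UNIV + CARD('n) * r \<le> N * m"
      by (rule of_nat_le_iff[THEN iffD1])
    moreover have "y = ?pt (r, f)"
      unfolding vec_eq_iff using y N by (simp add: f of_nat_diff field_simps)
    ultimately show "y \<in> ?pt ` ?A"
      using r by (intro image_eqI[of _ _ "(r, f)"]) auto
  qed
qed

text \<open>For fixed \<open>r\<close> the condition on \<open>f\<close> says that its sum is at
  most \<open>m - h r\<close>, which leaves vectors of bounded sum to count. The assumption on
  \<open>h\<close> characterises the ceiling of \<open>CARD('n) * r / N\<close> without
  division.\<close>

lemma card_lattice_points_dilated_one_row_simplex:
  fixes a :: "int ^ 'n::{finite,linorder}" and N m :: nat and h :: "nat \<Rightarrow> nat"
  assumes a: "a = (\<chi> i. if i = last_index then int N else int N - 1)" and N: "N > 0"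
    and h: "\<And>r s. r < N \<Longrightarrow> CARD('n) * r \<le> N * s \<longleftrightarrow> h r \<le> s"
  shows "card ((\<lambda>x. real m *\<^sub>R x) ` one_row_hnf_simplex a \<inter> integer_points) =
    (\<Sum>r<N. (m + CARD('n) - h r) choose CARD('n))"
proof -
  define F where "F = (\<lambda>r. {f :: 'n \<Rightarrow> nat. N * sum f UNIV + CARD('n) * r \<le> N * m})"
  have F: "finite (F r) \<and> card (F r) = (m + CARD('n) - h r) choose CARD('n)" if r: "r < N" for r
  proof -
    have iff: "N * s + CARD('n) * r \<le> N * m \<longleftrightarrow> h r \<le> m \<and> s \<le> m - h r" for s
    proof (cases "s \<le> m")
      case True
      then have "N * s + CARD('n) * r \<le> N * m \<longleftrightarrow> CARD('n) * r \<le> N * (m - s)"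
        by (auto simp: diff_mult_distrib2 le_diff_conv2)
      then show ?thesis
        using h[OF r, of "m - s"] True by auto
    next
      case False
      then have "N * m < N * s" using N by simp
      then show ?thesis using False by linarith
    qed
    show ?thesis
    proof (cases "h r \<le> m")
      case True
      then have "F r = {f. sum f UNIV \<le> m - h r}"
        by (simp add: F_def iff)
      then show ?thesis
        using True by (simp add: card_bounded_sum_UNIV)
    next
      case False
      \<comment> \<open>No \<open>f\<close> qualifies when \<open>h r > m\<close>. The binomial
        coefficient vanishes too: its upper entry stays below \<open>CARD('n)\<close>, even under
        truncated subtraction.\<close>
      moreover have "CARD('n) > 0" by simp
      ultimately have "m + CARD('n) - h r < CARD('n)" by linarith
      then show ?thesis
        using False by (simp add: F_def iff)
    qed
  qed
  have "card ((\<lambda>x. real m *\<^sub>R x) ` one_row_hnf_simplex a \<inter> integer_points) =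
      card (SIGMA r:{..<N}. F r)"
    using bij_betw_same_card[OF lattice_points_dilated_one_row_simplex[OF a N, of m]]
    by (simp add: F_def)
  also have "\<dots> = (\<Sum>r<N. card (F r))"
    using F by (intro card_SigmaI) auto
  finally show ?thesis
    using F by simp
qed

section \<open>Summation of the binomial coefficients\<close>

text \<open>Pascal's rule, iterated. The boundary term stands on the left to avoid subtraction of
  natural numbers.\<close>

lemma sum_choose_shift:
  "(\<Sum>i<n. (m + i) choose d) + (m choose Suc d) = (m + n) choose Suc d"
  by (induction n) auto

text \<open>The indices from 1 to \<open>d * k\<close> split into \<open>d\<close> blocks of length
  \<open>k\<close> on which \<open>(r - 1) div k\<close> is constant. Reversing the order of the
  blocks turns the sum over them into a hockey-stick sum.\<close>

lemma sum_choose_group: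
  assumes "k > 0"
  shows "(\<Sum>r\<in>{1..d * k}. (m + d - Suc ((r - 1) div k)) choose d) + k * (m choose Suc d) =
    k * ((m + d) choose Suc d)"
proof -
  define g where "g = (\<lambda>i. (m + d - Suc i) choose d)"
  have "(\<Sum>r\<in>{1..d * k}. g ((r - 1) div k)) = (\<Sum>r<d * k. g (r div k))"
    by (rule sum.reindex_bij_witness[of _ Suc "\<lambda>r. r - 1"]) auto
  also have "\<dots> = (\<Sum>i<d. \<Sum>r\<in>{i * k..<i * k + k}. g (r div k))"
    by (rule sum.nat_group[symmetric])
  also have "\<dots> = (\<Sum>i<d. \<Sum>r\<in>{i * k..<i * k + k}. g i)"
    by (intro sum.cong refl arg_cong[of _ _ g] div_nat_eqI) (auto simp: algebra_simps)
  also have "\<dots> = k * (\<Sum>i<d. g i)"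
    by (simp add: sum_distrib_left)
  also have "(\<Sum>i<d. g i) = (\<Sum>i<d. (m + i) choose d)"
    by (rule sum.reindex_bij_witness[of _ "\<lambda>i. d - Suc i" "\<lambda>i. d - Suc i"]) (auto simp: g_def)
  finally show ?thesis
    by (simp add: g_def flip: sum_choose_shift[of m d d] distrib_left)
qed

text \<open>In both cases \<open>\<lceil>d r / N\<rceil> = \<lceil>r / k\<rceil>\<close> for \<open>0 < r \<le> d k\<close>.\<close>

lemma ceiling_bound_iff:
  fixes d k r s N :: nat
  assumes "k > 0" "0 < r" "r \<le> d * k" "N = d * k \<or> N = d * k + 1"
  shows "d * r \<le> N * s \<longleftrightarrow> Suc ((r - 1) div k) \<le> s"
proof -
  define i where "i = (r - 1) div k"
  have "i < d"
    using assms by (auto simp: i_def div_less_iff_less_mult)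
  have "i * k \<le> r - 1"
    by (simp add: i_def)
  then have lo: "i * k + 1 \<le> r" using assms(2) by linarith
  have "r - 1 < Suc i * k"
    using assms(1) by (simp only: i_def flip: div_less_iff_less_mult)
  then have hi: "r \<le> Suc i * k" by linarith
  show ?thesis unfolding i_def[symmetric]
  proof
    assume "Suc i \<le> s"
    have "d * r \<le> d * (Suc i * k)" using hi by (rule mult_le_mono2)
    also have "\<dots> \<le> N * Suc i" using assms(4) by (auto simp: algebra_simps)
    also have "\<dots> \<le> N * s" using \<open>Suc i \<le> s\<close> by (rule mult_le_mono2)
    finally show "d * r \<le> N * s" .
  next
    assume *: "d * r \<le> N * s"
    show "Suc i \<le> s"
    proof (rule ccontr)
      assume "\<not> Suc i \<le> s"
      then have "N * s \<le> N * i" by (intro mult_le_mono2) linarith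
      also have "\<dots> \<le> d * k * i + i" using assms(4) by (auto simp: algebra_simps)
      \<comment> \<open>The possible extra unit in \<open>N\<close> costs at most \<open>i\<close>,
        and \<open>i < d\<close> absorbs it.\<close>
      also have "\<dots> < d * (i * k + 1)" using \<open>i < d\<close> by (simp add: algebra_simps)
      also have "\<dots> \<le> d * r" using lo by (rule mult_le_mono2)
      finally show False using * by linarith
    qed
  qed
qed

text \<open>The range \<open>r < N\<close> is all of \<open>{..d * k}\<close> if
  \<open>N = d * k + 1\<close> and misses only \<open>r = d * k\<close> if \<open>N = d * k\<close>.
  The missing term and the subtracted hockey-stick term are moved to the left.\<close>

lemma card_lattice_points_multiple:
  fixes a :: "int ^ 'n::{finite,linorder}" and N k m :: nat
  assumes a: "a = (\<chi> i. if i = last_index then int N else int N - 1)"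
    and k: "k > 0" and d: "d = CARD('n)" and N: "N = d * k \<or> N = d * k + 1"
  shows "card ((\<lambda>x. real m *\<^sub>R x) ` one_row_hnf_simplex a \<inter> integer_points)
      + k * (m choose Suc d) + (if N = d * k then m choose d else 0) =
    ((m + d) choose d) + k * ((m + d) choose Suc d)"
proof -
  \<comment> \<open>The case \<open>r = 0\<close> is separate since truncated subtraction would give
    the value 1 there instead of 0.\<close>
  define h where "h = (\<lambda>r. if r = 0 then 0 else Suc ((r - 1) div k))"
  define g where "g = (\<lambda>r. (m + d - h r) choose d)"
  have "d > 0" by (simp add: d)
  then have "N > 0" using k N by auto
  have "card ((\<lambda>x. real m *\<^sub>R x) ` one_row_hnf_simplex a \<inter> integer_points) = (\<Sum>r<N. g r)"
    unfolding g_def d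
  proof (rule card_lattice_points_dilated_one_row_simplex[OF a \<open>N > 0\<close>])
    fix r s assume "r < N"
    then show "CARD('n) * r \<le> N * s \<longleftrightarrow> h r \<le> s"
      using ceiling_bound_iff[OF k _ _ N, of r s] N by (auto simp: h_def d)
  qed
  moreover have "(\<Sum>r<N. g r) + (if N = d * k then m choose d else 0) = (\<Sum>r\<in>{..d * k}. g r)"
  proof (cases "N = d * k")
    case True
    \<comment> \<open>The missing index lies in the last block, where \<open>h\<close> equals
      \<open>d\<close>.\<close>
    have "(d * k - 1) div k = d - 1"
      using k \<open>d > 0\<close> by (intro div_nat_eqI) (auto simp: algebra_simps diff_mult_distrib)
    then have "g N = m choose d"
      using True \<open>N > 0\<close> \<open>d > 0\<close> by (simp add: g_def h_def)
    then show ?thesis using True by (simp flip: lessThan_Suc_atMost)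
  next
    case False
    then show ?thesis using N by (simp flip: lessThan_Suc_atMost)
  qed
  moreover have "(\<Sum>r\<in>{..d * k}. g r) = g 0 + (\<Sum>r\<in>{1..d * k}. g r)"
    by (simp add: sum.atMost_shift sum.atLeast1_atMost_eq lessThan_Suc_atMost)
  moreover have "(\<Sum>r\<in>{1..d * k}. g r) + k * (m choose Suc d) = k * ((m + d) choose Suc d)"
    using sum_choose_group[OF k, of m d] by (simp add: g_def h_def)
  ultimately show ?thesis
    by (simp add: g_def h_def)
qed

section \<open>Coefficients of rising and falling factorials\<close>

definition rising_poly :: "nat \<Rightarrow> real poly"
  where "rising_poly n = pochhammer [:0, 1:] n"

text \<open>This is \<open>(t + 1) ... (t + n)\<close>, the numerator of the binomial coefficient
  \<open>t + n\<close> over \<open>n\<close>.\<close>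

definition rising_poly1 :: "nat \<Rightarrow> real poly"
  where "rising_poly1 n = pochhammer [:1, 1:] n"

text \<open>This is \<open>t (t - 1) ... (t - n + 1)\<close>, encoded as a reflection of the rising
  factorial so that their coefficients differ only by signs.\<close>

definition falling_poly :: "nat \<Rightarrow> real poly"
  where "falling_poly n = smult ((-1) ^ n) (pcompose (rising_poly n) (monom (-1) 1))"

lemma poly_pochhammer: "poly (pochhammer p n) x = pochhammer (poly p x) n"
  by (simp add: pochhammer_prod poly_prod)

lemma poly_rising_poly: "poly (rising_poly (Suc d)) (real m) = fact (Suc d) * real ((m + d) choose Suc d)"
proof -
  have "real ((m + d) choose Suc d) = pochhammer (real m) (Suc d) / fact (Suc d)"
    unfolding binomial_gbinomial gbinomial_pochhammer' by simp
  then show ?thesis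
    by (simp add: rising_poly_def poly_pochhammer del: fact_Suc)
qed

lemma poly_rising_poly1: "poly (rising_poly1 d) (real m) = fact d * real ((m + d) choose d)"
  unfolding binomial_gbinomial gbinomial_pochhammer'
  by (simp add: rising_poly1_def poly_pochhammer add.commute)

lemma poly_falling_poly: "poly (falling_poly d) (real m) = fact d * real (m choose d)"
  unfolding binomial_gbinomial gbinomial_pochhammer
  by (simp add: falling_poly_def rising_poly_def poly_pochhammer poly_pcompose poly_monom)

lemma coeff_falling_poly: "coeff (falling_poly n) i = (-1) ^ (n + i) * coeff (rising_poly n) i"
  by (simp add: falling_poly_def coeff_pcompose_monom_linear power_add)

lemma rising_poly_Suc: "rising_poly (Suc n) = pCons 0 (rising_poly1 n)"
  by (simp add: rising_poly_def rising_poly1_def pochhammer_rec one_pCons)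

lemma rising_poly1_Suc: "rising_poly1 (Suc n) = pCons 0 (rising_poly1 n) + smult (real (Suc n)) (rising_poly1 n)"
  by (simp add: rising_poly1_def pochhammer_Suc of_nat_poly algebra_simps)

lemma degree_rising_poly1: "degree (rising_poly1 n) \<le> n"
proof (induction n)
  case (Suc n)
  then show ?case
    unfolding rising_poly1_Suc
    by (intro degree_add_le) (auto intro: order_trans[OF degree_pCons_le] order_trans[OF degree_smult_le])
qed (simp add: rising_poly1_def)

text \<open>Multiplication by \<open>t + n + 1\<close> adds a shifted copy of the coefficients to a
  positive multiple of them. The multiple makes the constant coefficient positive, the shift all
  others up to the new leading one.\<close>

lemma coeff_rising_poly1_pos: "i \<le> n \<Longrightarrow> coeff (rising_poly1 n) i > 0"
proof (induction n arbitrary: i)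
  case (Suc n)
  have nonneg: "coeff (rising_poly1 n) j \<ge> 0" for j
    using Suc.IH[of j] degree_rising_poly1[of n] by (cases "j \<le> n") (auto simp: coeff_eq_0)
  show ?case
  proof (cases i)
    case 0
    then show ?thesis
      using Suc.IH[of 0] by (simp add: rising_poly1_Suc)
  next
    case (Suc j)
    then have "coeff (rising_poly1 n) j > 0"
      using Suc.IH Suc.prems by simp
    then show ?thesis
      using nonneg[of i] Suc by (simp add: rising_poly1_Suc add_pos_nonneg)
  qed
qed (simp add: rising_poly1_def)

lemma coeff_rising_poly1_nonneg: "coeff (rising_poly1 n) i \<ge> 0"
  using coeff_rising_poly1_pos[of i n] degree_rising_poly1[of n]
  by (cases "i \<le> n") (auto simp: coeff_eq_0)

lemma coeff_rising_poly_nonneg: "coeff (rising_poly n) i \<ge> 0"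
proof (cases n)
  case 0
  then show ?thesis by (simp add: rising_poly_def)
next
  case (Suc e)
  then show ?thesis
    by (cases i) (auto simp: rising_poly_Suc coeff_rising_poly1_nonneg)
qed

lemma coeff_falling_poly_le: "coeff (falling_poly n) i \<le> coeff (rising_poly n) i"
  using coeff_rising_poly_nonneg[of n i]
  by (cases "even (n + i)") (auto simp: coeff_falling_poly)

text \<open>Splitting off the factor \<open>t + d\<close> gives
  \<open>rising_poly1 d = rising_poly d + d * rising_poly1 (d - 1)\<close> for \<open>d > 0\<close>,
  and \<open>rising_poly d\<close> dominates \<open>falling_poly d\<close>. Strictness stops below
  \<open>d\<close> because both polynomials are monic.\<close>

lemma coeff_rising_poly1_minus_falling:
  "coeff (rising_poly1 d - falling_poly d) i \<ge> 0"
  "i < d \<Longrightarrow> coeff (rising_poly1 d - falling_poly d) i > 0"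
proof -
  consider "d = 0" | e where "d = Suc e" by (cases d)
  then have "coeff (rising_poly1 d) i \<ge> coeff (rising_poly d) i \<and>
      (i < d \<longrightarrow> coeff (rising_poly1 d) i > coeff (rising_poly d) i)"
  proof cases
    case 1
    then show ?thesis by (simp add: rising_poly_def rising_poly1_def)
  next
    case (2 e)
    then have "coeff (rising_poly1 d) i = coeff (rising_poly d) i + real d * coeff (rising_poly1 e) i"
      by (simp only: rising_poly_Suc rising_poly1_Suc coeff_add coeff_smult)
    then show ?thesis
      using 2 coeff_rising_poly1_nonneg[of e i] coeff_rising_poly1_pos[of i e] by auto
  qed
  then show "coeff (rising_poly1 d - falling_poly d) i \<ge> 0"
    "i < d \<Longrightarrow> coeff (rising_poly1 d - falling_poly d) i > 0"
    using coeff_falling_poly_le[of d i] by auto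
qed

text \<open>The sign at index \<open>d\<close> is negative, so the difference is twice a positive
  coefficient of the rising factorial.\<close>

lemma coeff_rising_minus_falling_top:
  assumes "d > 0"
  shows "coeff (rising_poly (Suc d) - falling_poly (Suc d)) d > 0"
proof -
  obtain e where "d = Suc e" using assms gr0_implies_Suc by blast
  then have "coeff (rising_poly (Suc d)) d > 0"
    using coeff_rising_poly1_pos[of e d] by (simp add: rising_poly_Suc)
  then show ?thesis
    by (simp add: coeff_falling_poly)
qed

text \<open>The leading terms of degree \<open>d + 1\<close> cancel, which keeps the degree of the
  counting polynomial at \<open>d\<close>.\<close>

lemma coeff_rising_minus_falling_above:
  assumes "i > d"
  shows "coeff (rising_poly (Suc d) - falling_poly (Suc d)) i = 0"
proof (cases "i = Suc d")
  case False
  then obtain j where "i = Suc j" "j > d" using assms by (cases i) auto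
  then have "coeff (rising_poly (Suc d)) i = 0"
    using degree_rising_poly1[of d] by (simp add: rising_poly_Suc coeff_eq_0)
  then show ?thesis
    by (simp add: coeff_falling_poly)
qed (simp add: coeff_falling_poly)

section \<open>The Ehrhart polynomial and the signs of its coefficients\<close>

theorem theorem4p5:
  fixes a :: "int ^ 'n::{finite,linorder}" and d :: nat and N k :: int
  assumes "d = CARD('n)"
    and "k > 0"
    and "N = int d * k \<or> N = int d * k + 1"
    and "a = (\<chi> i. if i = last_index then N else N - 1)"
  shows "ehrhart_positive (one_row_hnf_simplex a)"
proof -
  define K where "K = nat k"
  define M where "M = nat N"
  have K: "K > 0" "k = int K" using assms(2) by (auto simp: K_def)
  have "N \<ge> 0" using assms(2,3) by auto
  then have M: "N = int M" by (simp add: M_def)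
  have "int M = int (d * K) \<or> int M = int (d * K + 1)"
    using assms(3) unfolding K M by (simp add: add.commute)
  then have MK: "M = d * K \<or> M = d * K + 1"
    by (simp only: of_nat_eq_iff)
  have "d > 0" using assms(1) by simp
  \<comment> \<open>After division by \<open>d!\<close> and \<open>(d + 1)!\<close>,
    \<open>A\<close> and \<open>B\<close> interpolate the two binomial differences in the lattice
    point count.\<close>
  define A where "A = rising_poly1 d - (if M = d * K then falling_poly d else 0)"
  define B where "B = rising_poly (Suc d) - falling_poly (Suc d)"
  define p where "p = smult (1 / fact d) A + smult (real K / fact (Suc d)) B"
  have count: "poly p (real m) =
      real (card ((\<lambda>x. real m *\<^sub>R x) ` one_row_hnf_simplex a \<inter> integer_points))" for m
  proof -
    define c where "c = card ((\<lambda>x. real m *\<^sub>R x) ` one_row_hnf_simplex a \<inter> integer_points)"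
    have "a = (\<chi> i. if i = last_index then int M else int M - 1)"
      using assms(4) unfolding M .
    from arg_cong[OF card_lattice_points_multiple[OF this K(1) assms(1) MK, of m], of real]
    have "real c = real ((m + d) choose d) - (if M = d * K then real (m choose d) else 0)
        + real K * (real ((m + d) choose Suc d) - real (m choose Suc d))"
      unfolding c_def[symmetric] by (simp add: algebra_simps split: if_splits)
    moreover have "poly A (real m) =
        fact d * (real ((m + d) choose d) - (if M = d * K then real (m choose d) else 0))"
      by (simp add: A_def poly_rising_poly1 poly_falling_poly algebra_simps)
    moreover have "poly B (real m) =
        fact (Suc d) * (real ((m + d) choose Suc d) - real (m choose Suc d))"
      by (simp add: B_def poly_rising_poly poly_falling_poly right_diff_distrib del: fact_Suc binomial_Suc_Suc)
    ultimately show ?thesis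
      by (simp add: p_def c_def[symmetric] del: fact_Suc binomial_Suc_Suc)
  qed
  have A_nonneg: "coeff A i \<ge> 0" for i
    using coeff_rising_poly1_minus_falling(1)[of d i] coeff_rising_poly1_nonneg[of d i]
    by (simp add: A_def)
  have A_pos: "coeff A i > 0" if "i < d" for i
    using coeff_rising_poly1_minus_falling(2)[OF that] coeff_rising_poly1_pos[of i d] that
    by (simp add: A_def)
  have A_above: "coeff A i = 0" if "i > d" for i
  proof -
    have "coeff (rising_poly d) i = 0"
      using degree_rising_poly1[of "d - 1"] that \<open>d > 0\<close>
      by (cases d; cases i) (auto simp: rising_poly_Suc coeff_eq_0)
    then show ?thesis
      using degree_rising_poly1[of d] that by (simp add: A_def coeff_falling_poly coeff_eq_0)
  qed
  have B_nonneg: "coeff B i \<ge> 0" for i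
    using coeff_falling_poly_le[of "Suc d" i] by (simp add: B_def)
  have pos: "coeff p i > 0" if "i \<le> d" for i
  \<comment> \<open>Below degree \<open>d\<close> positivity comes from \<open>A\<close>. In degree
    \<open>d\<close> the coefficient of \<open>A\<close> vanishes if \<open>M = d * K\<close>, so
    \<open>B\<close> has to supply it.\<close>
  proof (cases "i = d")
    case True
    have "coeff B d > 0"
      unfolding B_def by (rule coeff_rising_minus_falling_top[OF \<open>d > 0\<close>])
    then have "(real K / fact (Suc d)) * coeff B d > 0"
      using K(1) by (intro mult_pos_pos divide_pos_pos) auto
    then show ?thesis
      using A_nonneg[of d] True by (simp add: p_def add_nonneg_pos del: fact_Suc)
  next
    case False
    then show ?thesis
      using A_pos[of i] B_nonneg[of i] that by (simp add: p_def add_pos_nonneg del: fact_Suc)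
  qed
  have "degree p = d"
  proof (rule antisym)
    show "degree p \<le> d"
      by (rule degree_le) (auto simp: p_def A_above coeff_rising_minus_falling_above B_def simp del: coeff_diff)
    show "d \<le> degree p"
      using pos[of d] by (intro le_degree) simp
  qed
  then have "is_ehrhart_poly (one_row_hnf_simplex a) p"
    using count assms(1) by (simp add: is_ehrhart_poly_def)
  then show ?thesis
    using pos assms(1) by (auto simp: ehrhart_positive_def)
qed

end
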